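(* Let $\mathbb{K}$ be a field, let $n\ge2$, and let $\lambda_1,\dots,\lambda_n\in\mathbb{K}$ be pairwise distinct. For each $i\in\{1,\dots,n\}$ let $J_{\lambda_i}$ be a Jordan matrix of size $\xi_i\ge1$ whose only eigenvalue is $\lambda_i$. Let $R=\mathbb{K}[x^{(i)}_1,\dots,x^{(i)}_{\xi_i} : 1\le i\le n]$, let $\boldsymbol{x}_i=(x^{(i)}_1,\dots,x^{(i)}_{\xi_i})^T$, and let $\boldsymbol{x}$ be the column vector obtained by stacking $\boldsymbol{x}_1,\dots,\boldsymbol{x}_n$ vertically. Let $I_{\lambda_1\cdots\lambda_n}\subseteq R$ be the ideal generated by the $2\times2$ minors of $\bigl((J_{\lambda_1}\oplus\cdots\oplus J_{\lambda_n})\boldsymbol{x}\mid\boldsymbol{x}\bigr)$; for each $i$ let $L_{\lambda_i}$ be the set of $2\times2$ minors of $(J_{\lambda_i}\boldsymbol{x}_i\mid\boldsymbol{x}_i)$, and let $\mathfrak{p}_i\subseteq R$ be the ideal generated by all variables $x^{(i')}_\alpha$ with $i'\ne i$, $1\le\alpha\le\xi_{i'}$. Then $$I_{\lambda_1\cdots\lambda_n}=\bigcap_{i=1}^n\left(\langle L_{\lambda_i}\rangle+\mathfrak{p}_i\right).$$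
   Context: A Jordan matrix with single eigenvalue $\lambda$ is a direct sum of Jordan blocks with $\lambda$ on the diagonal and $1$ on the superdiagonal; up to permutation of blocks it is written $\bigoplus_{j=1}^{\ell}k_jJ_{\lambda,r_j}$, where $J_{\lambda,r}$ is the Jordan block of size $r$, $k_jJ_{\lambda,r_j}$ is the direct sum of $k_j\geq 1$ copies, and $r_1>\cdots>r_\ell\ge1$. For a square matrix $M$ and a column vector $\boldsymbol{y}$ of variables, $(M\boldsymbol{y}\mid\boldsymbol{y})$ is the two-column matrix with columns $M\boldsymbol{y}$ and $\boldsymbol{y}$. $\oplus$ denotes the block diagonal sum. *)

theory Defs
  imports
    "HOL-Library.Poly_Mapping"
    "HOL-Algebra.Ideal"
    "HOL-Algebra.Ring"
    "Jordan_Normal_Form.Determinant"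
    "Jordan_Normal_Form.DL_Submatrix"
    "Jordan_Normal_Form.Jordan_Normal_Form"
begin

text \<open>
  A polynomial is a finitely supported map from monomials to coefficients, a monomial being a
  finitely supported map from variables to exponents; multiplication on the outer type is
  convolution.
\<close>

type_synonym ('v, 'k) mpoly = "('v \<Rightarrow>\<^sub>0 nat) \<Rightarrow>\<^sub>0 'k"

definition Const :: "'k::zero \<Rightarrow> ('v, 'k) mpoly" where
  "Const c = Poly_Mapping.single 0 c"

definition Var :: "'v \<Rightarrow> ('v, 'k::zero_neq_one) mpoly" where
  "Var v = Poly_Mapping.single (Poly_Mapping.single v 1) 1"

definition vars :: "('v, 'k::zero) mpoly \<Rightarrow> 'v set" where
  "vars p = (\<Union>m\<in>Poly_Mapping.keys p. Poly_Mapping.keys m)"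

text \<open>
  The polynomial ring in the variables \<open>V\<close>. The variables are a subset of a type, so the ring is
  a proper subring of the type \<open>('v, 'k) mpoly\<close> in general; ideals below are ideals of this ring.
\<close>

definition poly_ring_in :: "'v set \<Rightarrow> ('v, 'k::comm_ring_1) mpoly ring" where
  "poly_ring_in V =
    \<lparr>carrier = {p. vars p \<subseteq> V}, monoid.mult = (*), one = 1, zero = 0, add = (+)\<rparr>"

lemma poly_ring_in_simps [simp]:
  "carrier (poly_ring_in V) = {p. vars p \<subseteq> V}"
  "x \<otimes>\<^bsub>poly_ring_in V\<^esub> y = x * y"
  "\<one>\<^bsub>poly_ring_in V\<^esub> = 1"
  "\<zero>\<^bsub>poly_ring_in V\<^esub> = 0"
  "x \<oplus>\<^bsub>poly_ring_in V\<^esub> y = x + y"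
  by (simp_all add: poly_ring_in_def)

lemma vars_zero [simp]: "vars 0 = {}"
  by (simp add: vars_def)

lemma vars_one [simp]: "vars (1 :: ('v, 'k::zero_neq_one) mpoly) = {}"
  by (simp add: vars_def)

lemma vars_Const [simp]: "vars (Const c) = {}"
  by (simp add: vars_def Const_def)

lemma vars_Var [simp]: "vars (Var v :: ('v, 'k::zero_neq_one) mpoly) = {v}"
  by (simp add: vars_def Var_def)

lemma vars_uminus [simp]: "vars (- p) = vars (p :: ('v, 'k::comm_ring_1) mpoly)"
  by (simp add: vars_def)

lemma vars_add: "vars (p + q) \<subseteq> vars p \<union> vars (q :: ('v, 'k::comm_ring_1) mpoly)"
  using Poly_Mapping.keys_add[of p q] by (auto simp: vars_def)

lemma vars_mult: "vars (p * q) \<subseteq> vars p \<union> vars (q :: ('v, 'k::comm_ring_1) mpoly)"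
proof
  fix v assume "v \<in> vars (p * q)"
  then obtain m where m: "m \<in> Poly_Mapping.keys (p * q)" "v \<in> Poly_Mapping.keys m"
    by (auto simp: vars_def)
  from m(1) obtain a b where "a \<in> Poly_Mapping.keys p" "b \<in> Poly_Mapping.keys q" "m = a + b"
    using keys_mult[of p q] by blast
  then show "v \<in> vars p \<union> vars q"
    using m(2) Poly_Mapping.keys_add[of a b] by (auto simp: vars_def)
qed

lemma cring_poly_ring_in: "cring (poly_ring_in V :: ('v, 'k::comm_ring_1) mpoly ring)"
proof (rule cringI)
  show "abelian_group (poly_ring_in V :: ('v, 'k) mpoly ring)"
  proof (rule abelian_groupI)
    fix x :: "('v, 'k) mpoly"
    assume "x \<in> carrier (poly_ring_in V)"
    then show "\<exists>y\<in>carrier (poly_ring_in V). y \<oplus>\<^bsub>poly_ring_in V\<^esub> x = \<zero>\<^bsub>poly_ring_in V\<^esub>"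
      by (intro bexI[of _ "- x"]) auto
  qed (use vars_add in \<open>force simp: algebra_simps\<close>)+
  show "comm_monoid (poly_ring_in V :: ('v, 'k) mpoly ring)"
    by (rule comm_monoidI) (use vars_mult in \<open>force simp: algebra_simps\<close>)+
qed (simp add: algebra_simps)

definition minors :: "nat \<Rightarrow> 'a::comm_ring_1 mat \<Rightarrow> 'a set" where
  "minors k A = {det (submatrix A S T) | S T.
     S \<subseteq> {..<dim_row A} \<and> card S = k \<and> T \<subseteq> {..<dim_col A} \<and> card T = k}"

text \<open>The two-column matrix \<open>(M y | y)\<close>, with the entries of \<open>M\<close> read as constant polynomials.\<close>

definition two_col_mat :: "'k::comm_ring_1 mat \<Rightarrow> ('v, 'k) mpoly vec \<Rightarrow> ('v, 'k) mpoly mat" where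
  "two_col_mat M y = mat_of_cols (dim_row M) [map_mat Const M *\<^sub>v y, y]"

text \<open>
  The blocks may come in any order. Blocks of size 0 are excluded; \<^const>\<open>jordan_block\<close> has its
  ones on the superdiagonal.
\<close>

definition is_jordan_matrix_with :: "'k::{zero,one} \<Rightarrow> 'k mat \<Rightarrow> bool" where
  "is_jordan_matrix_with a A \<longleftrightarrow>
    (\<exists>rs. 0 \<notin> set rs \<and> A = jordan_matrix (map (\<lambda>r. (r, a)) rs))"

text \<open>
  The variable \<open>x\<^sup>(\<^sup>i\<^sup>)\<^sub>\<alpha>\<close> is \<open>Var (i, \<alpha>)\<close>. Both indices are counted from 0, in accordance with the
  indexing of matrices and vectors: \<open>i < n\<close> and \<open>\<alpha> < \<xi> i\<close>.
\<close>

definition var_indices :: "nat \<Rightarrow> (nat \<Rightarrow> nat) \<Rightarrow> (nat \<times> nat) set" where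
  "var_indices n \<xi> = (SIGMA i:{..<n}. {..<\<xi> i})"

definition block_ring :: "nat \<Rightarrow> (nat \<Rightarrow> nat) \<Rightarrow> (nat \<times> nat, 'k::field) mpoly ring" where
  "block_ring n \<xi> = poly_ring_in (var_indices n \<xi>)"

definition block_vec :: "(nat \<Rightarrow> nat) \<Rightarrow> nat \<Rightarrow> (nat \<times> nat, 'k::field) mpoly vec" where
  "block_vec \<xi> i = vec (\<xi> i) (\<lambda>\<alpha>. Var (i, \<alpha>))"

definition stacked_vec :: "nat \<Rightarrow> (nat \<Rightarrow> nat) \<Rightarrow> (nat \<times> nat, 'k::field) mpoly vec" where
  "stacked_vec n \<xi> = vec_of_list (concat (map (\<lambda>i. list_of_vec (block_vec \<xi> i)) [0..<n]))"

definition jordan_ideal ::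
  "nat \<Rightarrow> (nat \<Rightarrow> nat) \<Rightarrow> (nat \<Rightarrow> 'k::field mat) \<Rightarrow> (nat \<times> nat, 'k) mpoly set" where
  "jordan_ideal n \<xi> J = Idl\<^bsub>block_ring n \<xi>\<^esub>
     (minors 2 (two_col_mat (diag_block_mat (map J [0..<n])) (stacked_vec n \<xi>)))"

definition block_minors ::
  "(nat \<Rightarrow> nat) \<Rightarrow> (nat \<Rightarrow> 'k::field mat) \<Rightarrow> nat \<Rightarrow> (nat \<times> nat, 'k) mpoly set" where
  "block_minors \<xi> J i = minors 2 (two_col_mat (J i) (block_vec \<xi> i))"

definition other_vars_ideal ::
  "nat \<Rightarrow> (nat \<Rightarrow> nat) \<Rightarrow> nat \<Rightarrow> (nat \<times> nat, 'k::field) mpoly set" where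
  "other_vars_ideal n \<xi> i = Idl\<^bsub>block_ring n \<xi>\<^esub>
     {Var (i', \<alpha>) | i' \<alpha>. i' < n \<and> i' \<noteq> i \<and> \<alpha> < \<xi> i'}"

end

theory Submission
  imports Defs
begin

text \<open>
  Write \<open>I\<close> for the left-hand ideal. Each \<open>J\<^sub>i\<close> is upper triangular with constant diagonal \<open>\<lambda>\<^sub>i\<close>, so the
  minor of \<open>I\<close> on row \<open>\<alpha>\<close> of block \<open>i\<close> and row \<open>\<beta>\<close> of block \<open>j \<noteq> i\<close> is \<open>(\<lambda>\<^sub>i - \<lambda>\<^sub>j) x\<^sup>(\<^sup>i\<^sup>)\<^sub>\<alpha> x\<^sup>(\<^sup>j\<^sup>)\<^sub>\<beta>\<close> plus
  products of variables of the same two blocks with a larger index; downward induction shows that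
  \<open>I\<close> contains every product of variables from different blocks. If
  \<open>p = l\<^sub>i + r\<^sub>i\<close> with \<open>l\<^sub>i \<in> \<langle>L\<^sub>i\<rangle>\<close> and \<open>r\<^sub>i \<in> \<pp>\<^sub>i\<close> for all \<open>i\<close>, then \<open>p - \<Sum>\<^sub>j l\<^sub>j\<close> lies in every \<open>\<pp>\<^sub>i\<close>, because
  \<open>\<langle>L\<^sub>j\<rangle> \<subseteq> \<pp>\<^sub>i\<close> for \<open>j \<noteq> i\<close>. Hence each of its monomials involves variables of two different blocks,
  and \<open>p \<in> I\<close>.
\<close>

section \<open>Ideals of the polynomial ring and the monomials of their elements\<close>

lemma Const_diff: "Const (a - b) = Const a - Const (b :: 'k::comm_ring_1)"
  by (simp add: Const_def single_diff)

lemma Const_mult: "Const (a * b) = Const a * Const (b :: 'k::comm_ring_1)"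
  by (simp add: Const_def mult_single)

lemma Const_0 [simp]: "Const 0 = 0"
  by (simp add: Const_def)

lemma Const_1 [simp]: "Const 1 = 1"
  by (simp add: Const_def)

lemma poly_mapping_sum_single:
  "p = (\<Sum>m\<in>Poly_Mapping.keys p. Poly_Mapping.single m (Poly_Mapping.lookup p m))"
  by (rule poly_mapping_eqI)
    (simp add: lookup_sum lookup_single when_def in_keys_iff)

text \<open>The additive inverse of HOL-Algebra is derived from the ring record. The hypothesis puts
  \<open>p\<close> in the carrier, where inverses are unique; ideals can then be handled with the
  type-class operations.\<close>

lemma a_inv_poly_ring_in:
  fixes p :: "('v, 'k::comm_ring_1) mpoly"
  assumes "vars p \<subseteq> V"
  shows "\<ominus>\<^bsub>poly_ring_in V\<^esub> p = - p"
proof -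
  interpret cring "poly_ring_in V :: ('v, 'k) mpoly ring"
    by (rule cring_poly_ring_in)
  show ?thesis
    by (rule minus_equality) (use assms in auto)
qed

context
  fixes V :: "'v set" and I :: "('v, 'k::comm_ring_1) mpoly set"
  assumes ideal: "ideal I (poly_ring_in V)"
begin

interpretation ideal I "poly_ring_in V"
  by (rule ideal)

lemma ideal_poly_ring_vars: "p \<in> I \<Longrightarrow> vars p \<subseteq> V"
  using Icarr by simp

lemma ideal_poly_ring_zero: "0 \<in> I"
  using additive_subgroup.zero_closed[OF is_additive_subgroup] by simp

lemma ideal_poly_ring_add: "p \<in> I \<Longrightarrow> q \<in> I \<Longrightarrow> p + q \<in> I"
  using additive_subgroup.a_closed[OF is_additive_subgroup] by simp

lemma ideal_poly_ring_uminus: "p \<in> I \<Longrightarrow> - p \<in> I"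
  using additive_subgroup.a_inv_closed[OF is_additive_subgroup, of p]
  by (simp add: a_inv_poly_ring_in ideal_poly_ring_vars)

lemma ideal_poly_ring_diff: "p \<in> I \<Longrightarrow> q \<in> I \<Longrightarrow> p - q \<in> I"
  using ideal_poly_ring_add[of p "- q"] ideal_poly_ring_uminus[of q] by simp

lemma ideal_poly_ring_mult: "p \<in> I \<Longrightarrow> vars q \<subseteq> V \<Longrightarrow> q * p \<in> I"
  using I_l_closed[of p q] by simp

lemma ideal_poly_ring_sum: "(\<And>a. a \<in> A \<Longrightarrow> f a \<in> I) \<Longrightarrow> (\<Sum>a\<in>A. f a) \<in> I"
  by (induction A rule: infinite_finite_induct)
    (auto intro: ideal_poly_ring_zero ideal_poly_ring_add)

end

lemma ideal_poly_ringI: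
  fixes I :: "('v, 'k::comm_ring_1) mpoly set"
  assumes "\<And>p. p \<in> I \<Longrightarrow> vars p \<subseteq> V" and "0 \<in> I"
    and "\<And>p q. p \<in> I \<Longrightarrow> q \<in> I \<Longrightarrow> p + q \<in> I"
    and mult: "\<And>p q. p \<in> I \<Longrightarrow> vars q \<subseteq> V \<Longrightarrow> q * p \<in> I"
  shows "ideal I (poly_ring_in V)"
proof -
  interpret cring "poly_ring_in V :: ('v, 'k) mpoly ring"
    by (rule cring_poly_ring_in)
  \<comment> \<open>\<open>- 1\<close> is a constant polynomial, so negation is a case of closure
    under multiplication.\<close>
  have uminus: "- p \<in> I" if "p \<in> I" for p
    using mult[OF that, of "- 1"] by simp
  show ?thesis
  proof (rule idealI)
    show "subgroup I (add_monoid (poly_ring_in V))"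
      by (rule add.subgroupI)
        (use assms uminus in \<open>auto simp: a_inv_poly_ring_in simp flip: a_inv_def\<close>)
  qed (use assms in \<open>auto simp: ring_axioms mult.commute\<close>)
qed

text \<open>The ideal generated by the variables in \<open>V\<close> that lie in \<open>S\<close>,
  encoded by the supports of its elements. Membership in several such ideals can then be read off
  monomial by monomial.\<close>

definition var_ideal :: "'v set \<Rightarrow> 'v set \<Rightarrow> ('v, 'k::comm_ring_1) mpoly set" where
  "var_ideal V S = {p. vars p \<subseteq> V \<and> (\<forall>m\<in>Poly_Mapping.keys p. Poly_Mapping.keys m \<inter> S \<noteq> {})}"

text \<open>Natural exponents cannot cancel, so no variable is lost when monomials are
  multiplied.\<close>

lemma keys_add_nat:
  "Poly_Mapping.keys (m + m') = Poly_Mapping.keys m \<union> Poly_Mapping.keys (m' :: 'v \<Rightarrow>\<^sub>0 nat)"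
  by (auto simp: in_keys_iff lookup_add)

lemma ideal_var_ideal:
  "ideal (var_ideal V S :: ('v, 'k::comm_ring_1) mpoly set) (poly_ring_in V)"
proof (rule ideal_poly_ringI)
  fix p q :: "('v, 'k) mpoly"
  assume p: "p \<in> var_ideal V S"
  show "vars p \<subseteq> V"
    using p by (simp add: var_ideal_def)
  show "p + q \<in> var_ideal V S" if "q \<in> var_ideal V S"
    using p that vars_add[of p q] Poly_Mapping.keys_add[of p q] by (auto simp: var_ideal_def)
  show "q * p \<in> var_ideal V S" if "vars q \<subseteq> V"
    unfolding var_ideal_def
  proof (intro CollectI conjI ballI)
    show "vars (q * p) \<subseteq> V"
      using p that vars_mult[of q p] by (auto simp: var_ideal_def)
    fix m assume "m \<in> Poly_Mapping.keys (q * p)"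
    then obtain a b where "b \<in> Poly_Mapping.keys p" "m = a + b"
      using keys_mult[of q p] by blast
    then show "Poly_Mapping.keys m \<inter> S \<noteq> {}"
      using p by (auto simp: var_ideal_def keys_add_nat)
  qed
qed (simp add: var_ideal_def)

lemma Var_in_var_ideal: "v \<in> S \<Longrightarrow> v \<in> V \<Longrightarrow> (Var v :: ('v, 'k::comm_ring_1) mpoly) \<in> var_ideal V S"
  by (simp add: var_ideal_def) (simp add: Var_def)

text \<open>Each term of \<open>p\<close> is a multiple of some \<open>Var v * Var w\<close> in
  \<open>I\<close>, and \<open>p\<close> is the sum of its terms.\<close>

lemma ideal_containing_monomials:
  fixes p :: "('v, 'k::comm_ring_1) mpoly"
  assumes I: "ideal I (poly_ring_in V)" and p: "vars p \<subseteq> V"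
    and keys: "\<And>m. m \<in> Poly_Mapping.keys p \<Longrightarrow>
      \<exists>v\<in>Poly_Mapping.keys m. \<exists>w\<in>Poly_Mapping.keys m. v \<noteq> w \<and> Var v * Var w \<in> I"
  shows "p \<in> I"
proof -
  have "Poly_Mapping.single m c \<in> I" if m: "m \<in> Poly_Mapping.keys p" for m c
  proof -
    obtain v w where vw: "v \<in> Poly_Mapping.keys m" "w \<in> Poly_Mapping.keys m" "v \<noteq> w"
      "Var v * Var w \<in> I"
      using keys[OF m] by blast
    \<comment> \<open>Division of the monomial by both variables: since \<open>v\<close> and
      \<open>w\<close> differ and both occur in \<open>m\<close>, the truncated subtraction is
      exact.\<close>
    define m' where "m' = m - Poly_Mapping.single v 1 - Poly_Mapping.single w 1"
    have m_eq: "m = m' + (Poly_Mapping.single v 1 + Poly_Mapping.single w 1)"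
      using vw
      by (intro poly_mapping_eqI)
        (auto simp: m'_def lookup_add lookup_minus lookup_single when_def in_keys_iff)
    have "Poly_Mapping.single m c = Poly_Mapping.single m' c * (Var v * Var w)"
      by (subst m_eq) (simp add: Var_def mult_single)
    \<comment> \<open>The cofactor has to lie in the ring as well; its variables already occur in
      \<open>p\<close>.\<close>
    moreover have "Poly_Mapping.keys m' \<subseteq> Poly_Mapping.keys m"
      unfolding m_eq keys_add_nat by blast
    then have "vars (Poly_Mapping.single m' c) \<subseteq> V"
      using p m by (auto simp: vars_def split: if_splits)
    ultimately show ?thesis
      using ideal_poly_ring_mult[OF I vw(4)] by simp
  qed
  then show ?thesis
    by (subst poly_mapping_sum_single) (rule ideal_poly_ring_sum[OF I])
qed

section \<open>Minors of a two-column matrix\<close>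

lemma det_2x2:
  fixes A :: "'a::comm_ring_1 mat"
  assumes A: "A \<in> carrier_mat 2 2"
  shows "det A = A $$ (0, 0) * A $$ (1, 1) - A $$ (0, 1) * A $$ (1, 0)"
proof -
  have "det (mat_delete A 0 j) = A $$ (1, 1 - j)" if "j < 2" for j
  proof -
    have "mat_delete A 0 j \<in> carrier_mat 1 1"
      using A by (auto simp: mat_delete_def)
    then have "det (mat_delete A 0 j) = mat_delete A 0 j $$ (0, 0)"
      by (rule det_single)
    then show ?thesis
      using A that by (auto simp: mat_delete_def less_2_cases_iff)
  qed
  then show ?thesis
    using laplace_expansion_row[OF A, of 0]
    by (simp add: cofactor_def numeral_2_eq_2)
qed

text \<open>\<open>submatrix\<close> numbers a selected index set increasingly via
  \<open>pick\<close>; the assumption \<open>a < b\<close> thus fixes which row comes first, and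
  with it the sign of the minor.\<close>

lemma pick_pair:
  assumes "a < b"
  shows "pick {a, b} 0 = a" "pick {a, b} (Suc 0) = b"
proof -
  show *: "pick {a, b} 0 = a"
    using assms by (auto intro!: Least_equality)
  show "pick {a, b} (Suc 0) = b"
    using assms * by (auto intro!: Least_equality)
qed

lemma det_submatrix_two_rows:
  fixes A :: "'a::comm_ring_1 mat"
  assumes "dim_col A = 2" "a < b" "b < dim_row A"
  shows "det (submatrix A {a, b} {..<2}) = A $$ (a, 0) * A $$ (b, 1) - A $$ (a, 1) * A $$ (b, 0)"
proof -
  have rows: "{i. i < dim_row A \<and> i \<in> {a, b}} = {a, b}"
    and cols: "{j. j < dim_col A \<and> j \<in> {..<2}} = {..<2}"
    using assms by auto
  have two: "{..<2} = {0, Suc 0}"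
    by auto
  have carrier: "submatrix A {a, b} {..<2} \<in> carrier_mat 2 2"
    using assms(2) by (intro carrier_matI) (simp_all only: dim_submatrix rows cols, simp_all)
  have entry: "submatrix A {a, b} {..<2} $$ (i, j) = A $$ (pick {a, b} i, pick {0, Suc 0} j)"
    if "i < 2" "j < 2" for i j
    unfolding two[symmetric]
    using assms(2) that by (intro submatrix_index) (simp_all only: rows cols, simp_all)
  show ?thesis
    unfolding det_2x2[OF carrier] using assms(2) by (simp add: entry pick_pair del: pick.simps)
qed

text \<open>Both columns must be selected, and a two-element set of rows has a unique increasing
  listing.\<close>

lemma minors_two_col_mat:
  assumes "dim_vec y = dim_row M"
  shows "minors 2 (two_col_mat M y) =
    {(map_mat Const M *\<^sub>v y) $ a * y $ b - y $ a * (map_mat Const M *\<^sub>v y) $ b | a b.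
      a < b \<and> b < dim_row M}"
proof -
  let ?A = "two_col_mat M y"
  have dim: "dim_row ?A = dim_row M" "dim_col ?A = 2"
    by (simp_all add: two_col_mat_def)
  have det: "det (submatrix ?A {a, b} {..<2}) =
      (map_mat Const M *\<^sub>v y) $ a * y $ b - y $ a * (map_mat Const M *\<^sub>v y) $ b"
    if "a < b" "b < dim_row M" for a b
    using that by (subst det_submatrix_two_rows)
      (auto simp: dim two_col_mat_def mat_of_cols_index simp del: index_mult_mat_vec)
  have T: "T = {..<2}" if "T \<subseteq> {..<dim_col ?A}" "card T = 2" for T
    using that dim by (intro card_subset_eq) auto
  have S: "\<exists>a b. a < b \<and> b < dim_row M \<and> S = {a, b}"
    if S: "S \<subseteq> {..<dim_row ?A}" "card S = 2" for S
  proof -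
    obtain a b where "S = {a, b}" "a \<noteq> b"
      using S(2) by (auto simp: card_2_iff)
    then show ?thesis
      using S(1) dim by (cases a b rule: linorder_cases) auto
  qed
  show ?thesis
  proof (intro equalityI subsetI)
    fix d assume "d \<in> minors 2 ?A"
    then obtain S T where d: "d = det (submatrix ?A S T)" and "S \<subseteq> {..<dim_row ?A}" "card S = 2"
      "T \<subseteq> {..<dim_col ?A}" "card T = 2"
      unfolding minors_def by blast
    then obtain a b where "a < b" "b < dim_row M" "S = {a, b}" "T = {..<2}"
      using S T by metis
    then show "d \<in> {(map_mat Const M *\<^sub>v y) $ a * y $ b - y $ a * (map_mat Const M *\<^sub>v y) $ b | a b.
      a < b \<and> b < dim_row M}"
      using d det by blast
  next
    fix d assume "d \<in> {(map_mat Const M *\<^sub>v y) $ a * y $ b - y $ a * (map_mat Const M *\<^sub>v y) $ b | a b.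
      a < b \<and> b < dim_row M}"
    then obtain a b where ab: "a < b" "b < dim_row M"
      and d: "d = (map_mat Const M *\<^sub>v y) $ a * y $ b - y $ a * (map_mat Const M *\<^sub>v y) $ b"
      by (elim CollectE exE conjE)
    then have "d = det (submatrix ?A {a, b} {..<2})"
      using det by (simp del: index_mult_mat_vec)
    moreover have "{a, b} \<subseteq> {..<dim_row ?A}" "card {a, b} = 2" "{..<2} \<subseteq> {..<dim_col ?A}"
      "card {..<2::nat} = 2"
      using ab dim by auto
    ultimately show "d \<in> minors 2 ?A"
      unfolding minors_def by (intro CollectI exI[of _ "{a, b}"] exI[of _ "{..<2}"] conjI)
  qed
qed

text \<open>For matching sizes, the rows of \<open>two_col_mat M y\<close>, kept as a set without
  their positions, so that a block diagonal sum turns into a union.\<close>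

definition row_pairs ::
  "'k::comm_ring_1 mat \<Rightarrow> ('v, 'k) mpoly vec \<Rightarrow> (('v, 'k) mpoly \<times> ('v, 'k) mpoly) set" where
  "row_pairs M y = (\<lambda>a. ((map_mat Const M *\<^sub>v y) $ a, y $ a)) ` {..<dim_vec y}"

text \<open>Exchanging two rows changes the sign of a minor and repeating a row gives 0, so an ideal
  containing the minors of all increasing pairs of rows contains those of arbitrary pairs. This
  removes the row order from the later arguments.\<close>

lemma minors_subset_ideal_iff:
  fixes M :: "'k::comm_ring_1 mat" and y :: "('v, 'k) mpoly vec"
  assumes I: "ideal I (poly_ring_in V)" and dim: "dim_vec y = dim_row M"
  shows "minors 2 (two_col_mat M y) \<subseteq> I \<longleftrightarrow>
    (\<forall>(u, x)\<in>row_pairs M y. \<forall>(u', x')\<in>row_pairs M y. u * x' - x * u' \<in> I)"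
proof
  let ?u = "map_mat Const M *\<^sub>v y"
  assume "minors 2 (two_col_mat M y) \<subseteq> I"
  then have less: "?u $ a * y $ b - y $ a * ?u $ b \<in> I" if "a < b" "b < dim_row M" for a b
    using that unfolding minors_two_col_mat[OF dim] by blast
  have "?u $ a * y $ b - y $ a * ?u $ b \<in> I" if "a < dim_row M" "b < dim_row M" for a b
  proof (cases a b rule: linorder_cases)
    case less
    then show ?thesis using \<open>\<And>a b. a < b \<Longrightarrow> b < dim_row M \<Longrightarrow> _ a b \<in> I\<close> that by blast
  next
    case equal
    then show ?thesis using ideal_poly_ring_zero[OF I] by (simp add: mult.commute)
  next
    case greater
    then have "- (?u $ b * y $ a - y $ b * ?u $ a) \<in> I"
      using less that by (intro ideal_poly_ring_uminus[OF I]) blast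
    then show ?thesis by (simp add: mult.commute)
  qed
  then show "\<forall>(u, x)\<in>row_pairs M y. \<forall>(u', x')\<in>row_pairs M y. u * x' - x * u' \<in> I"
    using dim by (auto simp: row_pairs_def simp del: index_mult_mat_vec)
next
  assume "\<forall>(u, x)\<in>row_pairs M y. \<forall>(u', x')\<in>row_pairs M y. u * x' - x * u' \<in> I"
  then show "minors 2 (two_col_mat M y) \<subseteq> I"
    unfolding minors_two_col_mat[OF dim]
    using dim by (fastforce simp: row_pairs_def simp del: index_mult_mat_vec)
qed

text \<open>The entries of \<open>M y\<close> are combinations of the entries of \<open>y\<close>
  with constant coefficients.\<close>

lemma row_pairs_subset_ideal:
  fixes M :: "'k::comm_ring_1 mat" and y :: "('v, 'k) mpoly vec"
  assumes "ideal I (poly_ring_in V)" and "M \<in> carrier_mat (dim_vec y) (dim_vec y)"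
    and "\<And>a. a < dim_vec y \<Longrightarrow> y $ a \<in> I"
  shows "row_pairs M y \<subseteq> I \<times> I"
  using assms(2,3)
  by (auto simp: row_pairs_def scalar_prod_def
      intro!: ideal_poly_ring_sum[OF assms(1)] ideal_poly_ring_mult[OF assms(1)])

section \<open>Rows of block diagonal sums\<close>

lemma map_mat_Const_four_block_diag:
  "map_mat Const (four_block_mat A (0\<^sub>m (dim_row A) (dim_col B)) (0\<^sub>m (dim_row B) (dim_col A)) B) =
   four_block_mat (map_mat Const A) (0\<^sub>m (dim_row A) (dim_col B)) (0\<^sub>m (dim_row B) (dim_col A))
     (map_mat Const (B :: 'k::comm_ring_1 mat))"
  by (rule eq_matI) auto

lemma vec_of_list_append: "vec_of_list (xs @ ys) = vec_of_list xs @\<^sub>v vec_of_list ys"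
  by (rule eq_vecI) (auto simp: vec_of_list_index nth_append)

lemma row_pairs_append:
  fixes A B :: "'k::comm_ring_1 mat" and y z :: "('v, 'k) mpoly vec"
  assumes A: "A \<in> carrier_mat (dim_vec y) (dim_vec y)"
    and B: "B \<in> carrier_mat (dim_vec z) (dim_vec z)"
  shows "row_pairs (four_block_mat A (0\<^sub>m (dim_row A) (dim_col B)) (0\<^sub>m (dim_row B) (dim_col A)) B)
    (y @\<^sub>v z) = row_pairs A y \<union> row_pairs B z"
proof -
  let ?M = "four_block_mat A (0\<^sub>m (dim_row A) (dim_col B)) (0\<^sub>m (dim_row B) (dim_col A)) B"
  have mult: "map_mat Const ?M *\<^sub>v (y @\<^sub>v z) = (map_mat Const A *\<^sub>v y) @\<^sub>v (map_mat Const B *\<^sub>v z)"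
    unfolding map_mat_Const_four_block_diag using A B
    by (auto intro!: mult_mat_vec_split)
  have rows: "{..<dim_vec (y @\<^sub>v z)} = {..<dim_vec y} \<union> (\<lambda>a. dim_vec y + a) ` {..<dim_vec z}"
    unfolding lessThan_atLeast0 image_add_atLeastLessThan by auto
  show ?thesis
    unfolding row_pairs_def mult rows image_Un image_image
    using carrier_matD[OF A] carrier_matD[OF B]
    by (intro arg_cong2[of _ _ _ _ "(\<union>)"] image_cong refl)
      (simp_all del: index_mult_mat_vec)
qed

text \<open>Induction along the blocks with \<open>row_pairs_append\<close>. The dimensions are part
  of the claim because that step requires the remaining blocks to fit the remaining vector.\<close>

lemma row_pairs_diag_block_mat:
  fixes A :: "'i \<Rightarrow> 'k::comm_ring_1 mat" and y :: "'i \<Rightarrow> ('v, 'k) mpoly vec"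
  assumes "\<And>i. i \<in> set is \<Longrightarrow> A i \<in> carrier_mat (dim_vec (y i)) (dim_vec (y i))"
  shows "diag_block_mat (map A is) \<in> carrier_mat
      (dim_vec (vec_of_list (concat (map (\<lambda>i. list_of_vec (y i)) is))))
      (dim_vec (vec_of_list (concat (map (\<lambda>i. list_of_vec (y i)) is)))) \<and>
    row_pairs (diag_block_mat (map A is)) (vec_of_list (concat (map (\<lambda>i. list_of_vec (y i)) is))) =
      (\<Union>i\<in>set is. row_pairs (A i) (y i))"
  using assms
proof (induction "is")
  case Nil
  then show ?case by (auto simp: row_pairs_def)
next
  case (Cons i "is")
  let ?z = "vec_of_list (concat (map (\<lambda>i. list_of_vec (y i)) is))"
  have IH: "diag_block_mat (map A is) \<in> carrier_mat (dim_vec ?z) (dim_vec ?z)"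
    "row_pairs (diag_block_mat (map A is)) ?z = (\<Union>i\<in>set is. row_pairs (A i) (y i))"
    using Cons by simp_all
  have A: "A i \<in> carrier_mat (dim_vec (y i)) (dim_vec (y i))"
    using Cons.prems by simp
  have z: "vec_of_list (concat (map (\<lambda>i. list_of_vec (y i)) (i # is))) = y i @\<^sub>v ?z"
    by (simp only: list.map concat.simps vec_of_list_append vec_list)
  show ?case
    unfolding z unfolding list.map diag_block_mat.simps Let_def
  proof (intro conjI)
    show "row_pairs (four_block_mat (A i) (0\<^sub>m (dim_row (A i)) (dim_col (diag_block_mat (map A is))))
        (0\<^sub>m (dim_row (diag_block_mat (map A is))) (dim_col (A i))) (diag_block_mat (map A is)))
        (y i @\<^sub>v ?z) = (\<Union>i\<in>set (i # is). row_pairs (A i) (y i))"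
      unfolding row_pairs_append[OF A IH(1)] IH(2) by simp
  qed (use carrier_matD[OF A] carrier_matD[OF IH(1)] in \<open>auto intro!: carrier_matI\<close>)
qed

section \<open>Jordan matrices and products of variables from two blocks\<close>

lemma jordan_matrix_diag:
  "i < sum_list rs \<Longrightarrow> jordan_matrix (map (\<lambda>r. (r, a)) rs) $$ (i, i) = a"
proof (induction rs arbitrary: i)
  case (Cons r rs)
  have "sum_list (map fst (map (\<lambda>r. (r, a)) rs)) = sum_list rs"
    by (simp add: comp_def)
  then show ?case
    using Cons by (auto simp: jordan_matrix_Cons)
qed simp

lemma is_jordan_matrix_with_entries:
  assumes "is_jordan_matrix_with a A" and "A \<in> carrier_mat d d"
  shows "i < d \<Longrightarrow> A $$ (i, i) = a" and "i < d \<Longrightarrow> j < i \<Longrightarrow> A $$ (i, j) = 0"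
proof -
  obtain rs where A: "A = jordan_matrix (map (\<lambda>r. (r, a)) rs)"
    using assms(1) by (auto simp: is_jordan_matrix_with_def)
  have sum: "sum_list (map fst (map (\<lambda>r. (r, a)) rs)) = sum_list rs"
    by (simp add: comp_def)
  then have "d = sum_list rs"
    using assms(2) A by (metis carrier_matD(1) jordan_matrix_dim(1))
  then show "i < d \<Longrightarrow> A $$ (i, i) = a" and "i < d \<Longrightarrow> j < i \<Longrightarrow> A $$ (i, j) = 0"
    using A sum by (auto simp: jordan_matrix_diag intro: jordan_matrix_upper_triangular)
qed

text \<open>Splitting off the eigenvalue term leaves variables of strictly larger index, as the
  downward induction requires.\<close>

lemma mult_block_vec_triangular:
  fixes M :: "'k::field mat"
  assumes M: "M \<in> carrier_mat (\<xi> i) (\<xi> i)" and \<alpha>: "\<alpha> < \<xi> i"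
    and diag: "M $$ (\<alpha>, \<alpha>) = a" and lower: "\<And>\<gamma>. \<gamma> < \<alpha> \<Longrightarrow> M $$ (\<alpha>, \<gamma>) = 0"
  shows "(map_mat Const M *\<^sub>v block_vec \<xi> i) $ \<alpha> =
    Const a * Var (i, \<alpha>) + (\<Sum>\<gamma>\<in>{\<alpha><..<\<xi> i}. Const (M $$ (\<alpha>, \<gamma>)) * Var (i, \<gamma>))"
proof -
  have "(map_mat Const M *\<^sub>v block_vec \<xi> i) $ \<alpha> =
      (\<Sum>\<gamma>\<in>{0..<\<xi> i}. Const (M $$ (\<alpha>, \<gamma>)) * Var (i, \<gamma>))"
    using M \<alpha> by (auto simp: scalar_prod_def block_vec_def intro!: sum.cong)
  also have "\<dots> = (\<Sum>\<gamma>\<in>insert \<alpha> {\<alpha><..<\<xi> i}. Const (M $$ (\<alpha>, \<gamma>)) * Var (i, \<gamma>))"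
  proof (rule sum.mono_neutral_right)
    show "\<forall>\<gamma>\<in>{0..<\<xi> i} - insert \<alpha> {\<alpha><..<\<xi> i}.
        Const (M $$ (\<alpha>, \<gamma>)) * (Var (i, \<gamma>) :: (nat \<times> nat, 'k) mpoly) = 0"
      using lower by (auto simp: not_less_iff_gr_or_eq)
  qed (use \<alpha> in auto)
  finally show ?thesis
    using diag by simp
qed

text \<open>Concerns one pair of blocks and any ideal containing the minors with one row from each.
  Modulo products covered by the induction hypothesis, such a minor is a unit times
  \<open>Var (i, \<alpha>) * Var (j, \<beta>)\<close>.\<close>

lemma cross_products_in_ideal:
  fixes M N :: "'k::field mat"
  assumes I: "ideal I (poly_ring_in V)"
    and V: "\<And>\<gamma>. \<gamma> < \<xi> i \<Longrightarrow> (i, \<gamma>) \<in> V" "\<And>\<gamma>. \<gamma> < \<xi> j \<Longrightarrow> (j, \<gamma>) \<in> V"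
    and M: "M \<in> carrier_mat (\<xi> i) (\<xi> i)" "is_jordan_matrix_with a M"
    and N: "N \<in> carrier_mat (\<xi> j) (\<xi> j)" "is_jordan_matrix_with b N"
    and "a \<noteq> b"
    and minors: "\<forall>(u, x)\<in>row_pairs M (block_vec \<xi> i).
      \<forall>(u', x')\<in>row_pairs N (block_vec \<xi> j). u * x' - x * u' \<in> I"
    and "\<alpha> < \<xi> i" "\<beta> < \<xi> j"
  shows "Var (i, \<alpha>) * Var (j, \<beta>) \<in> I"
  using \<open>\<alpha> < \<xi> i\<close> \<open>\<beta> < \<xi> j\<close>
\<comment> \<open>The measure is the total distance of the two indices from the ends of their
  blocks; it drops when either index grows. At the last index of both blocks the sums
  \<open>?u\<close> and \<open>?w\<close> are empty.\<close>
proof (induction "(\<xi> i - \<alpha>) + (\<xi> j - \<beta>)" arbitrary: \<alpha> \<beta> rule: less_induct)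
  case less
  let ?u = "\<Sum>\<gamma>\<in>{\<alpha><..<\<xi> i}. Const (M $$ (\<alpha>, \<gamma>)) * Var (i, \<gamma>)"
  let ?w = "\<Sum>\<gamma>\<in>{\<beta><..<\<xi> j}. Const (N $$ (\<beta>, \<gamma>)) * Var (j, \<gamma>)"
  let ?x = "Var (i, \<alpha>) :: (nat \<times> nat, 'k) mpoly" and ?y = "Var (j, \<beta>) :: (nat \<times> nat, 'k) mpoly"
  have "(map_mat Const M *\<^sub>v block_vec \<xi> i) $ \<alpha> * block_vec \<xi> j $ \<beta> -
      block_vec \<xi> i $ \<alpha> * (map_mat Const N *\<^sub>v block_vec \<xi> j) $ \<beta> \<in> I"
    using minors less.prems
    by (force simp: row_pairs_def block_vec_def simp del: index_mult_mat_vec)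
  moreover have "(map_mat Const M *\<^sub>v block_vec \<xi> i) $ \<alpha> = Const a * ?x + ?u"
    using less.prems is_jordan_matrix_with_entries[OF M(2,1)]
    by (intro mult_block_vec_triangular M) auto
  moreover have "(map_mat Const N *\<^sub>v block_vec \<xi> j) $ \<beta> = Const b * ?y + ?w"
    using less.prems is_jordan_matrix_with_entries[OF N(2,1)]
    by (intro mult_block_vec_triangular N) auto
  ultimately have minor: "(Const a * ?x + ?u) * ?y - ?x * (Const b * ?y + ?w) \<in> I"
    using less.prems by (simp add: block_vec_def)
  have "Var (i, \<gamma>) * ?y \<in> I" if "\<gamma> \<in> {\<alpha><..<\<xi> i}" for \<gamma>
    using that less.prems by (intro less.hyps) auto
  then have uy: "?u * ?y \<in> I"
    unfolding sum_distrib_right mult.assoc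
    by (auto intro!: ideal_poly_ring_sum[OF I] ideal_poly_ring_mult[OF I _, of "Var _ * Var _"])
  have "?x * ?w = (\<Sum>\<gamma>\<in>{\<beta><..<\<xi> j}. Const (N $$ (\<beta>, \<gamma>)) * (?x * Var (j, \<gamma>)))"
    by (simp add: sum_distrib_left mult.left_commute)
  moreover have "?x * Var (j, \<gamma>) \<in> I" if "\<gamma> \<in> {\<beta><..<\<xi> j}" for \<gamma>
    using that less.prems by (intro less.hyps) auto
  ultimately have xw: "?x * ?w \<in> I"
    by (auto intro!: ideal_poly_ring_sum[OF I] ideal_poly_ring_mult[OF I _, of "Var _ * Var _"])
  \<comment> \<open>The minor equals \<open>Const (a - b) * (?x * ?y) + ?u * ?y - ?x * ?w\<close>,
    hence these two corrections.\<close>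
  have "(Const a * ?x + ?u) * ?y - ?x * (Const b * ?y + ?w) - ?u * ?y + ?x * ?w \<in> I"
    by (intro ideal_poly_ring_add[OF I] ideal_poly_ring_diff[OF I] minor uy xw)
  also have "(Const a * ?x + ?u) * ?y - ?x * (Const b * ?y + ?w) - ?u * ?y + ?x * ?w =
      Const (a - b) * (?x * ?y)"
    by (simp add: Const_diff algebra_simps)
  \<comment> \<open>Since \<open>a \<noteq> b\<close>, the difference is a unit of the field and the
    constant factor can be cancelled inside the ideal.\<close>
  finally have "Const (inverse (a - b)) * (Const (a - b) * (?x * ?y)) \<in> I"
    by (rule ideal_poly_ring_mult[OF I]) simp
  moreover have "Const (inverse (a - b)) * Const (a - b) = (1 :: (nat \<times> nat, 'k) mpoly)"
    using \<open>a \<noteq> b\<close> by (simp flip: Const_mult)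
  ultimately show ?case
    by (simp flip: mult.assoc)
qed

section \<open>Comparison of the ideal of minors with the intersection\<close>

theorem theorem4p5:
  fixes n :: nat and lam :: "nat \<Rightarrow> 'k::field" and \<xi> :: "nat \<Rightarrow> nat" and J :: "nat \<Rightarrow> 'k mat"
  assumes "n \<ge> 2"
    and "inj_on lam {..<n}"
    and "\<And>i. i < n \<Longrightarrow> \<xi> i \<ge> 1"
    and "\<And>i. i < n \<Longrightarrow> J i \<in> carrier_mat (\<xi> i) (\<xi> i)"
    and "\<And>i. i < n \<Longrightarrow> is_jordan_matrix_with (lam i) (J i)"
  shows "jordan_ideal n \<xi> J =
    (\<Inter>i<n. Idl\<^bsub>block_ring n \<xi>\<^esub> (block_minors \<xi> J i)
      <+>\<^bsub>block_ring n \<xi>\<^esub> other_vars_ideal n \<xi> i)"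
proof -
  define V where "V = var_indices n \<xi>"
  define R where "R = (poly_ring_in V :: (nat \<times> nat, 'k) mpoly ring)"
  define y :: "nat \<Rightarrow> (nat \<times> nat, 'k) mpoly vec" where "y = block_vec \<xi>"
  define P :: "nat \<Rightarrow> ((nat \<times> nat, 'k) mpoly \<times> (nat \<times> nat, 'k) mpoly) set"
    where "P i = row_pairs (J i) (y i)" for i
  define I where "I = jordan_ideal n \<xi> J"
  define L where "L i = Idl\<^bsub>R\<^esub> (block_minors \<xi> J i)" for i
  define Q :: "nat \<Rightarrow> (nat \<times> nat, 'k) mpoly set" where "Q i = other_vars_ideal n \<xi> i" for i
  interpret R: cring R
    unfolding R_def by (rule cring_poly_ring_in)
  have block_ring: "block_ring n \<xi> = R"
    by (simp add: block_ring_def R_def V_def)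
  have V_iff: "(i, \<alpha>) \<in> V \<longleftrightarrow> i < n \<and> \<alpha> < \<xi> i" for i \<alpha>
    by (simp add: V_def var_indices_def)
  have y: "dim_vec (y i) = \<xi> i" "\<alpha> < \<xi> i \<Longrightarrow> y i $ \<alpha> = Var (i, \<alpha>)" for i \<alpha>
    by (simp_all add: y_def block_vec_def)
  have J: "J i \<in> carrier_mat (dim_vec (y i)) (dim_vec (y i))" if "i < n" for i
    using assms(4) that y by simp
  have stacked: "diag_block_mat (map J [0..<n]) \<in> carrier_mat
      (dim_vec (stacked_vec n \<xi> :: (nat \<times> nat, 'k) mpoly vec))
      (dim_vec (stacked_vec n \<xi> :: (nat \<times> nat, 'k) mpoly vec)) \<and>
    row_pairs (diag_block_mat (map J [0..<n])) (stacked_vec n \<xi>) = (\<Union>i\<in>set [0..<n]. P i)"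
    unfolding stacked_vec_def P_def y_def
    by (rule row_pairs_diag_block_mat) (use J in \<open>simp add: y_def\<close>)
  \<comment> \<open>\<open>K\<close> stays arbitrary: the criterion serves for the whole ring, for
    \<open>I\<close> and for each sum of \<open>L i\<close> and \<open>Q i\<close>.\<close>
  have minors_iff: "minors 2 (two_col_mat (diag_block_mat (map J [0..<n])) (stacked_vec n \<xi>)) \<subseteq> K \<longleftrightarrow>
      (\<forall>i<n. \<forall>j<n. \<forall>(u, x)\<in>P i. \<forall>(u', x')\<in>P j. u * x' - x * u' \<in> K)" if K: "ideal K R" for K
  proof -
    have dim: "dim_vec (stacked_vec n \<xi> :: (nat \<times> nat, 'k) mpoly vec) =
        dim_row (diag_block_mat (map J [0..<n]))"
      using stacked by (metis carrier_matD(1))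
    have "(\<forall>z\<in>(\<Union>i\<in>set [0..<n]. P i). \<forall>z'\<in>(\<Union>i\<in>set [0..<n]. P i). S z z') \<longleftrightarrow>
        (\<forall>i<n. \<forall>j<n. \<forall>z\<in>P i. \<forall>z'\<in>P j. S z z')" for S
      by fastforce
    then show ?thesis
      unfolding minors_subset_ideal_iff[OF K[unfolded R_def] dim] stacked[THEN conjunct2] split_beta .
  qed
  have block_minors_iff: "block_minors \<xi> J i \<subseteq> K \<longleftrightarrow>
      (\<forall>(u, x)\<in>P i. \<forall>(u', x')\<in>P i. u * x' - x * u' \<in> K)" if "ideal K R" "i < n" for K i
    using that J[OF that(2)] unfolding R_def block_minors_def P_def y_def
    by (intro minors_subset_ideal_iff) auto
  \<comment> \<open>With the ring as unit ideal, the criteria above also show that the minors are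
    elements of the ring, which is required before they can generate an ideal of it.\<close>
  have carrier_ideal: "ideal (carrier R) R"
    by (rule R.oneideal)
  have Var_carrier: "y i $ \<alpha> \<in> carrier R" if "i < n" "\<alpha> < dim_vec (y i)" for i \<alpha>
    using that by (simp add: y R_def V_iff)
  have P_subset: "P i \<subseteq> K \<times> K" if "ideal K R" "i < n" "\<And>\<alpha>. \<alpha> < \<xi> i \<Longrightarrow> Var (i, \<alpha>) \<in> K" for i K
    unfolding P_def using that J[of i]
    by (intro row_pairs_subset_ideal) (auto simp: R_def y)
  \<comment> \<open>One row inside the ideal suffices, since each of the two products in the minor
    has a factor from it.\<close>
  have diff_mult: "u * x' - x * u' \<in> K"
    if "ideal K R" "(u, x) \<in> K \<times> K" "(u', x') \<in> carrier R \<times> carrier R" for u x u' x' K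
  proof -
    have "x' * u - u' * x \<in> K"
      using that unfolding R_def by (auto intro!: ideal_poly_ring_diff ideal_poly_ring_mult)
    then show ?thesis by (simp add: mult.commute)
  qed
  have P_carrier: "P i \<subseteq> carrier R \<times> carrier R" if "i < n" for i
    using that by (intro P_subset carrier_ideal) (auto simp: R_def V_iff)
  have I_ideal: "ideal I R" and I_minors: "\<And>i j u x u' x'. i < n \<Longrightarrow> j < n \<Longrightarrow>
      (u, x) \<in> P i \<Longrightarrow> (u', x') \<in> P j \<Longrightarrow> u * x' - x * u' \<in> I"
  proof -
    let ?G = "minors 2 (two_col_mat (diag_block_mat (map J [0..<n])) (stacked_vec n \<xi>))"
    have G: "?G \<subseteq> carrier R"
      unfolding minors_iff[OF carrier_ideal] using P_carrier diff_mult[OF carrier_ideal] by blast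
    then show *: "ideal I R"
      unfolding I_def jordan_ideal_def block_ring by (rule R.genideal_ideal)
    have "?G \<subseteq> I"
      unfolding I_def jordan_ideal_def block_ring by (rule R.genideal_self[OF G])
    then show "\<And>i j u x u' x'. i < n \<Longrightarrow> j < n \<Longrightarrow>
      (u, x) \<in> P i \<Longrightarrow> (u', x') \<in> P j \<Longrightarrow> u * x' - x * u' \<in> I"
      unfolding minors_iff[OF *] by fast
  qed
  have L_carrier: "block_minors \<xi> J i \<subseteq> carrier R" if "i < n" for i
    unfolding block_minors_iff[OF carrier_ideal that]
    using P_carrier[OF that] diff_mult[OF carrier_ideal] by blast
  then have L_ideal: "ideal (L i) R" if "i < n" for i
    using that unfolding L_def by (intro R.genideal_ideal) simp
  \<comment> \<open>Two rows of the same block are also two rows of the whole matrix.\<close>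
  have L_I: "L i \<subseteq> I" if "i < n" for i
    unfolding L_def
    by (rule R.genideal_minimal[OF I_ideal])
      (use that in \<open>auto simp: block_minors_iff[OF I_ideal] intro: I_minors\<close>)
  \<comment> \<open>The rows of block \<open>j\<close> are built from variables of that block, and
    these all lie outside block \<open>i\<close>.\<close>
  have L_subset_var_ideal: "L j \<subseteq> var_ideal V {v. fst v \<noteq> i}" if "j < n" "i \<noteq> j" for i j
  proof -
    have K: "ideal (var_ideal V {v. fst v \<noteq> i}) R"
      unfolding R_def by (rule ideal_var_ideal)
    have "P j \<subseteq> var_ideal V {v. fst v \<noteq> i} \<times> var_ideal V {v. fst v \<noteq> i}"
      using that by (intro P_subset K Var_in_var_ideal) (auto simp: V_iff)
    then have "block_minors \<xi> J j \<subseteq> var_ideal V {v. fst v \<noteq> i}"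
      unfolding block_minors_iff[OF K that(1)]
      using diff_mult[OF K] P_carrier[OF that(1)] by blast
    then show ?thesis
      unfolding L_def by (rule R.genideal_minimal[OF K])
  qed
  let ?X = "\<lambda>i. {Var (i', \<alpha>) | i' \<alpha>. i' < n \<and> i' \<noteq> i \<and> \<alpha> < \<xi> i'} :: (nat \<times> nat, 'k) mpoly set"
  have X_carrier: "?X i \<subseteq> carrier R" for i
    by (auto simp: R_def V_iff)
  have Q_eq: "Q i = Idl\<^bsub>R\<^esub> (?X i)" for i
    by (simp add: Q_def other_vars_ideal_def block_ring)
  have Q_ideal: "ideal (Q i) R" for i
    unfolding Q_eq by (rule R.genideal_ideal[OF X_carrier])
  have Var_Q: "Var (j, \<alpha>) \<in> Q i" if "j < n" "j \<noteq> i" "\<alpha> < \<xi> j" for i j \<alpha>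
    unfolding Q_eq using R.genideal_self[OF X_carrier, of i] that by blast
  have Q_subset_var_ideal: "Q i \<subseteq> var_ideal V {v. fst v \<noteq> i}" for i
    unfolding Q_eq R_def
    by (rule R.genideal_minimal[unfolded R_def, OF ideal_var_ideal])
      (auto simp: V_iff intro: Var_in_var_ideal)
  have set_add_iff: "p \<in> A <+>\<^bsub>R\<^esub> B \<longleftrightarrow> (\<exists>a\<in>A. \<exists>b\<in>B. p = a + b)" for p A B
    by (auto simp: set_add_def set_mult_def R_def poly_ring_in_def)

  \<comment> \<open>This inclusion is checked on minors: one with a row outside block
    \<open>i\<close> lies in \<open>?K\<close> because of \<open>Q i\<close>; otherwise both rows
    belong to block \<open>i\<close> and the minor lies in \<open>L i\<close>.\<close>
  have "I \<subseteq> L i <+>\<^bsub>R\<^esub> Q i" if i: "i < n" for i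
  proof -
    let ?K = "L i <+>\<^bsub>R\<^esub> Q i"
    have K: "ideal ?K R"
      by (rule R.add_ideals[OF L_ideal[OF i] Q_ideal])
    have L_K: "L i \<subseteq> ?K"
      using ideal_poly_ring_zero[OF Q_ideal[unfolded R_def]] by (force simp: set_add_iff)
    have Q_K: "Q i \<subseteq> ?K"
      using ideal_poly_ring_zero[OF L_ideal[OF i, unfolded R_def]] by (force simp: set_add_iff)
    have P_Q: "P j \<subseteq> ?K \<times> ?K" if "j < n" "j \<noteq> i" for j
      using that Q_K by (intro P_subset K) (auto intro: Var_Q)
    have "u * x' - x * u' \<in> ?K"
      if "j < n" "k < n" and ux: "(u, x) \<in> P j" "(u', x') \<in> P k" for j k u x u' x'
    proof -
      consider "j \<noteq> i" | "k \<noteq> i" | "j = i" "k = i" by blast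
      then show ?thesis
      proof cases
        case 1
        then show ?thesis
          using diff_mult[OF K] P_Q P_carrier that by blast
      next
        case 2
        \<comment> \<open>\<open>diff_mult\<close> expects the row inside the ideal first, so the
          rows are exchanged and the sign is restored afterwards.\<close>
        then have "u' * x - x' * u \<in> ?K"
          using diff_mult[OF K] P_Q P_carrier that by blast
        then have "- (u' * x - x' * u) \<in> ?K"
          by (rule ideal_poly_ring_uminus[OF K[unfolded R_def], folded R_def])
        then show ?thesis by (simp add: mult.commute)
      next
        case 3
        have "block_minors \<xi> J i \<subseteq> L i"
          unfolding L_def by (rule R.genideal_self[OF L_carrier[OF i]])
        then show ?thesis
          using ux 3 L_K unfolding block_minors_iff[OF L_ideal[OF i] i] by fast
      qed
    qed
    then show ?thesis
      unfolding I_def jordan_ideal_def block_ring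
      by (intro R.genideal_minimal[OF K]) (auto simp: minors_iff[OF K])
  qed
  moreover have "p \<in> I" if p: "p \<in> (\<Inter>i<n. L i <+>\<^bsub>R\<^esub> Q i)" for p
  proof -
    note ideal_I = I_ideal[unfolded R_def]
    have "\<forall>i<n. \<exists>l. l \<in> L i \<and> p - l \<in> Q i"
      using p by (fastforce simp: set_add_iff)
    then obtain l where l: "\<And>i. i < n \<Longrightarrow> l i \<in> L i" "\<And>i. i < n \<Longrightarrow> p - l i \<in> Q i"
      by metis
    \<comment> \<open>All \<open>l j\<close> are subtracted at once, so that \<open>q\<close> does
      not depend on \<open>i\<close>.\<close>
    define q where "q = p - (\<Sum>j<n. l j)"
    have q: "q \<in> var_ideal V {v. fst v \<noteq> i}" if i: "i < n" for i
    proof -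
      \<comment> \<open>Relative to block \<open>i\<close>, the term \<open>l i\<close> brings
        \<open>p\<close> into \<open>Q i\<close>, while every other \<open>l j\<close> already lies
        in the ideal of the variables outside block \<open>i\<close>.\<close>
      have "q = (p - l i) - (\<Sum>j\<in>{..<n} - {i}. l j)"
        using i by (simp add: q_def sum.remove[of "{..<n}" i])
      also have "\<dots> \<in> var_ideal V {v. fst v \<noteq> i}"
      proof (rule ideal_poly_ring_diff[OF ideal_var_ideal _ ideal_poly_ring_sum[OF ideal_var_ideal]])
        show "p - l i \<in> var_ideal V {v. fst v \<noteq> i}"
          using l(2)[OF i] Q_subset_var_ideal by (rule subsetD[rotated])
        show "l j \<in> var_ideal V {v. fst v \<noteq> i}" if "j \<in> {..<n} - {i}" for j
          using l(1)[of j] L_subset_var_ideal[of j i] that by auto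
      qed
      finally show ?thesis .
    qed
    have "q \<in> I"
    proof (rule ideal_containing_monomials[OF ideal_I])
      have "0 < n" using assms(1) by simp
      then show q_vars: "vars q \<subseteq> V"
        using q[of 0] by (simp add: var_ideal_def)
      fix m assume m: "m \<in> Poly_Mapping.keys q"
      have other: "\<exists>j \<alpha>. (j, \<alpha>) \<in> Poly_Mapping.keys m \<and> j \<noteq> i \<and> j < n \<and> \<alpha> < \<xi> j"
        if "i < n" for i
      proof -
        obtain v where "v \<in> Poly_Mapping.keys m" "fst v \<noteq> i"
          using q[OF \<open>i < n\<close>] m unfolding var_ideal_def by blast
        moreover from this have "v \<in> V"
          using q_vars m by (auto simp: vars_def)
        ultimately show ?thesis
          by (cases v) (auto simp: V_iff)
      qed
      \<comment> \<open>Block 0 serves only as a start: it yields a variable of \<open>m\<close>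
        from some block \<open>j\<close>, and the condition for block \<open>j\<close> then yields
        one from a different block \<open>k\<close>.\<close>
      obtain j \<alpha> where j: "(j, \<alpha>) \<in> Poly_Mapping.keys m" "j < n" "\<alpha> < \<xi> j"
        using other[OF \<open>0 < n\<close>] by blast
      obtain k \<beta> where k: "(k, \<beta>) \<in> Poly_Mapping.keys m" "k \<noteq> j" "k < n" "\<beta> < \<xi> k"
        using other[OF \<open>j < n\<close>] by blast
      have "lam j \<noteq> lam k"
        using assms(2) j k by (auto simp: inj_on_def)
      have "Var (j, \<alpha>) * Var (k, \<beta>) \<in> I"
      proof (rule cross_products_in_ideal[OF ideal_I])
        show "J j \<in> carrier_mat (\<xi> j) (\<xi> j)" "J k \<in> carrier_mat (\<xi> k) (\<xi> k)"
          "is_jordan_matrix_with (lam j) (J j)" "is_jordan_matrix_with (lam k) (J k)"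
          using assms(4,5) j(2) k(3) by blast+
        show "\<forall>(u, x)\<in>row_pairs (J j) (block_vec \<xi> j). \<forall>(u', x')\<in>row_pairs (J k) (block_vec \<xi> k).
            u * x' - x * u' \<in> I"
          using I_minors[OF j(2) k(3)] unfolding P_def y_def by blast
      qed (use \<open>lam j \<noteq> lam k\<close> j k in \<open>simp_all add: V_iff\<close>)
      then show "\<exists>v\<in>Poly_Mapping.keys m. \<exists>w\<in>Poly_Mapping.keys m. v \<noteq> w \<and> Var v * Var w \<in> I"
        using j(1) k(1,2) by (intro bexI[of _ "(j, \<alpha>)"] bexI[of _ "(k, \<beta>)"] conjI) auto
    qed
    moreover have "(\<Sum>j<n. l j) \<in> I"
      by (rule ideal_poly_ring_sum[OF ideal_I]) (use l(1) L_I in auto)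
    ultimately have "q + (\<Sum>j<n. l j) \<in> I"
      by (rule ideal_poly_ring_add[OF ideal_I])
    then show ?thesis
      by (simp add: q_def)
  qed
  ultimately have "I = (\<Inter>i<n. L i <+>\<^bsub>R\<^esub> Q i)"
    by (intro equalityI subsetI INT_I) auto
  then show ?thesis
    by (simp add: I_def L_def Q_def block_ring)
qed

end
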